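(* Let $q=2^e$. Let $L_m(q)$ be the bipartite graph whose vertex set is the disjoint union of a point set $\mathbb{F}_q^{m+1}$ and a line set $\mathbb{F}_q^{m+1}$, with a point $P=(p_1,\dots,p_{m+1})$ adjacent to a line $L=[l_1,\dots,l_{m+1}]$ if and only if $l_k+p_k=p_1^{\,2^{k-2}}\,l_1$ for all $k=2,\dots,m+1$. Suppose either $e=m=1$, or $e\ge1$ and $m\ge2$. Then the girth of $L_m(q)$ is $8$.
   Context: The girth is the length of a shortest cycle in the graph. *)

theory Defs
  imports
    "Graph_Theory.Pair_Digraph"
    "HOL-Library.FuncSet"
    "HOL-Library.Extended_Nat"
    "HOL-Library.Cardinality"
begin

text \<open>
  A simple graph is a symmetric loop-free digraph (locale \<^locale>\<open>pair_graph\<close>), every edge being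
  a pair of opposite arcs.  Going back and forth along one edge is a cycle of length 2 in the sense
  of \<^const>\<open>pre_digraph.cycle\<close>; the cycles of the underlying simple graph are those with at least
  three arcs.  The girth is \<open>\<infinity>\<close> if there are none.
\<close>

definition girth :: "'v pair_pre_digraph \<Rightarrow> enat" where
  "girth G = (INF c \<in> {c. pre_digraph.cycle (with_proj G) c \<and> length c \<ge> 3}. enat (length c))"

text \<open>
  Vectors of length \<open>n\<close> are functions on the index set \<open>{1..n}\<close>, with the fixed value
  \<^const>\<open>undefined\<close> outside of it.
\<close>

abbreviation vectors :: "nat \<Rightarrow> (nat \<Rightarrow> 'a) set" where
  "vectors n \<equiv> {1..n} \<rightarrow>\<^sub>E UNIV"

definition incident :: "nat \<Rightarrow> (nat \<Rightarrow> 'a::field) \<Rightarrow> (nat \<Rightarrow> 'a) \<Rightarrow> bool" where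
  "incident m p l \<longleftrightarrow> (\<forall>k \<in> {2..m + 1}. l k + p k = p 1 ^ (2 ^ (k - 2)) * l 1)"

text \<open>Points are tagged with \<^const>\<open>Inl\<close>, lines with \<^const>\<open>Inr\<close>.\<close>

definition L_graph :: "'a::field itself \<Rightarrow> nat \<Rightarrow> ((nat \<Rightarrow> 'a) + (nat \<Rightarrow> 'a)) pair_pre_digraph" where
  "L_graph F m =
    \<lparr> pverts = vectors (m + 1) <+> vectors (m + 1),
      parcs = {(Inl p, Inr l) | p l. p \<in> vectors (m + 1) \<and> l \<in> vectors (m + 1) \<and> incident m p l}
            \<union> {(Inr l, Inl p) | p l. p \<in> vectors (m + 1) \<and> l \<in> vectors (m + 1) \<and> incident m p l} \<rparr>"

lemma pair_graph_L_graph: "pair_graph (L_graph TYPE('a::{field,finite}) m)"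
proof -
  let ?G = "L_graph TYPE('a) m"
  have fin: "finite (pverts ?G)"
    by (auto simp: L_graph_def intro!: finite_PiE)
  have sub: "parcs ?G \<subseteq> pverts ?G \<times> pverts ?G"
    by (auto simp: L_graph_def)
  show ?thesis
  proof
    show "finite (parcs ?G)"
      using fin sub by (meson finite_SigmaI finite_subset)
    show "symmetric (with_proj ?G)"
      by (auto simp: symmetric_def L_graph_def intro!: symI)
  qed (use fin sub in \<open>auto simp: L_graph_def\<close>)
qed

end

theory Submission
  imports Defs
begin

text \<open>
  Two vertices of the same kind with a common neighbour and the same first coordinate coincide.
  A closed walk alternates between points and lines, so a cycle of length less than 8 has
  length 4 or 6.  If \<open>x\<close> and \<open>y\<close> are the first coordinates of two points on a line with first
  coordinate \<open>a\<close>, the second coordinates of the points differ by \<open>(x - y) * a\<close> and the third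
  coordinates by \<open>(x\<^sup>2 - y\<^sup>2) * a\<close>.  Around a hexagon with points \<open>x, y, z\<close> and lines \<open>a, b, c\<close>
  these differences add up to 0, and eliminating \<open>a\<close> leaves \<open>(y - z) * (z - x) * (b - c) = 0\<close>,
  so two of the vertices coincide.  Over the field with two elements already \<open>x, y, z\<close> cannot be
  distinct.  In characteristic 2 an octagon is obtained from vectors that are constant beyond their
  first coordinate.
\<close>

text \<open>The incidence equations express \<open>p k\<close> through \<open>l\<close> and
  \<open>p 1\<close>, so the first coordinate determines a neighbour of \<open>l\<close>.\<close>

lemma point_eqI:
  assumes "p \<in> vectors (m + 1)" "p' \<in> vectors (m + 1)"
    and "incident m p l" "incident m p' l" "p 1 = p' 1"
  shows "p = p'"
proof (rule PiE_ext[OF assms(1,2)])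
  fix k assume "k \<in> {1..m + 1}"
  then consider "k = 1" | "k \<in> {2..m + 1}" by fastforce
  then show "p k = p' k"
  proof cases
    case 2
    then have "l k + p k = l k + p' k"
      using assms(3-5) by (simp add: incident_def)
    then show ?thesis by simp
  qed (use assms(5) in simp)
qed

lemma line_eqI:
  assumes "l \<in> vectors (m + 1)" "l' \<in> vectors (m + 1)"
    and "incident m p l" "incident m p l'" "l 1 = l' 1"
  shows "l = l'"
proof (rule PiE_ext[OF assms(1,2)])
  fix k assume "k \<in> {1..m + 1}"
  then consider "k = 1" | "k \<in> {2..m + 1}" by fastforce
  then show "l k = l' k"
  proof cases
    case 2
    then have "l k + p k = l' k + p k"
      using assms(3-5) by (simp add: incident_def)
    then show ?thesis by simp
  qed (use assms(5) in simp)
qed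

lemma incident_diff:
  assumes "incident m p l" "incident m q l" "k \<in> {2..m + 1}"
  shows "p k - q k = (p 1 ^ (2 ^ (k - 2)) - q 1 ^ (2 ^ (k - 2))) * l 1"
proof -
  have "l k + p k = p 1 ^ (2 ^ (k - 2)) * l 1" "l k + q k = q 1 ^ (2 ^ (k - 2)) * l 1"
    using assms by (auto simp: incident_def)
  then show ?thesis by (metis add_diff_cancel_left left_diff_distrib)
qed

text \<open>Coordinate 2 alone gives \<open>(p 1 - q 1) * (l 1 - l' 1) = 0\<close>, and both pairs
  have a common neighbour.\<close>

lemma no_square:
  assumes "p \<in> vectors (m + 1)" "q \<in> vectors (m + 1)"
    and "l \<in> vectors (m + 1)" "l' \<in> vectors (m + 1)" and "m \<ge> 1"
    and inc: "incident m p l" "incident m q l" "incident m p l'" "incident m q l'"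
  shows "p = q \<or> l = l'"
proof -
  have "p 2 - q 2 = (p 1 - q 1) * l 1" "p 2 - q 2 = (p 1 - q 1) * l' 1"
    using incident_diff[OF inc(1,2), of 2] incident_diff[OF inc(3,4), of 2] \<open>m \<ge> 1\<close> by auto
  then have "p 1 = q 1 \<or> l 1 = l' 1" by (metis mult_left_cancel right_minus_eq)
  then show ?thesis using assms point_eqI line_eqI by blast
qed

lemma no_hexagon:
  assumes "p \<in> vectors (m + 1)" "q \<in> vectors (m + 1)" "r \<in> vectors (m + 1)"
    and "b \<in> vectors (m + 1)" "c \<in> vectors (m + 1)" and "m \<ge> 2"
    and inc: "incident m p a" "incident m q a" "incident m q b" "incident m r b"
      "incident m r c" "incident m p c"
  shows "q = r \<or> r = p \<or> b = c"
proof -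
  have 2: "p 2 - q 2 = (p 1 - q 1) * a 1" "q 2 - r 2 = (q 1 - r 1) * b 1"
      "r 2 - p 2 = (r 1 - p 1) * c 1"
    using incident_diff[OF inc(1,2), of 2] incident_diff[OF inc(3,4), of 2]
      incident_diff[OF inc(5,6), of 2] \<open>m \<ge> 2\<close> by auto
  have 3: "p 3 - q 3 = ((p 1)^2 - (q 1)^2) * a 1" "q 3 - r 3 = ((q 1)^2 - (r 1)^2) * b 1"
      "r 3 - p 3 = ((r 1)^2 - (p 1)^2) * c 1"
    using incident_diff[OF inc(1,2), of 3] incident_diff[OF inc(3,4), of 3]
      incident_diff[OF inc(5,6), of 3] \<open>m \<ge> 2\<close> by auto
  have "(p 1 - q 1) * a 1 + (q 1 - r 1) * b 1 + (r 1 - p 1) * c 1 = 0"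
    unfolding 2[symmetric] by simp
  moreover have "((p 1)^2 - (q 1)^2) * a 1 + ((q 1)^2 - (r 1)^2) * b 1 + ((r 1)^2 - (p 1)^2) * c 1 = 0"
    unfolding 3[symmetric] by simp
  \<comment> \<open>Subtracting \<open>p 1 + q 1\<close> times the first relation from the second
    cancels the terms in \<open>a 1\<close>.\<close>
  ultimately have "(q 1 - r 1) * (r 1 - p 1) * (b 1 - c 1) = 0" by algebra
  then have "q 1 = r 1 \<or> r 1 = p 1 \<or> b 1 = c 1" by simp
  then show ?thesis using assms point_eqI line_eqI by blast
qed

text \<open>Pigeonhole: two of the three first coordinates agree, and any two of the points share a
  line.\<close>

lemma no_hexagon_two_elements:
  fixes p q r :: "nat \<Rightarrow> 'a::{field,finite}"
  assumes "p \<in> vectors (m + 1)" "q \<in> vectors (m + 1)" "r \<in> vectors (m + 1)"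
    and card: "CARD('a) = 2"
    and "incident m p a" "incident m q a" "incident m q b" "incident m r b"
      "incident m r c" "incident m p c"
  shows "p = q \<or> q = r \<or> r = p"
proof -
  have "card {p 1, q 1, r 1} \<le> 2"
    using card_mono[of UNIV "{p 1, q 1, r 1}"] card by simp
  then have "p 1 = q 1 \<or> q 1 = r 1 \<or> r 1 = p 1"
    by (auto simp: card_insert_if split: if_splits)
  then show ?thesis using assms point_eqI by metis
qed

lemma L_graph_arcs_simps [simp]:
  "(Inl p, Inr l) \<in> parcs (L_graph F m) \<longleftrightarrow>
    p \<in> vectors (m + 1) \<and> l \<in> vectors (m + 1) \<and> incident m p l"
  "(Inr l, Inl p) \<in> parcs (L_graph F m) \<longleftrightarrow>
    p \<in> vectors (m + 1) \<and> l \<in> vectors (m + 1) \<and> incident m p l"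
  "(Inl p, Inl p') \<notin> parcs (L_graph F m)"
  "(Inr l, Inr l') \<notin> parcs (L_graph F m)"
  by (auto simp: L_graph_def)

lemma L_graph_verts_simps [simp]:
  "Inl p \<in> pverts (L_graph F m) \<longleftrightarrow> p \<in> vectors (m + 1)"
  "Inr l \<in> pverts (L_graph F m) \<longleftrightarrow> l \<in> vectors (m + 1)"
  by (auto simp: L_graph_def)

lemma L_graph_walk_parity:
  assumes "set c \<subseteq> parcs (L_graph F m)" "pcas u c v"
  shows "isl u = isl v \<longleftrightarrow> even (length c)"
  using assms
proof (induction c arbitrary: u)
  case (Cons e c)
  obtain w where e: "e = (u, w)" using Cons.prems by (cases e) auto
  have "isl u \<noteq> isl w" using Cons.prems(1) e by (cases u; cases w) auto
  then show ?case using Cons e by auto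
qed simp

text \<open>In this form simp can evaluate \<open>pcas\<close> and \<open>pawalk_verts\<close> on
  explicit lists of arcs.\<close>

lemma L_graph_cycle_iff:
  "pre_digraph.cycle (with_proj (L_graph F m)) c \<longleftrightarrow>
    (\<exists>u. u \<in> pverts (L_graph F m) \<and> set c \<subseteq> parcs (L_graph F m) \<and> pcas u c u
      \<and> distinct (tl (pawalk_verts u c)) \<and> c \<noteq> [])"
  by (simp add: pre_digraph.cycle_def pre_digraph.awalk_def cas_with_proj_eq
      awalk_verts_with_proj_eq conj_assoc)

lemma L_graph_cycle_length_ge:
  assumes cyc: "pre_digraph.cycle (with_proj (L_graph TYPE('a::{field,finite}) m)) c"
    and "length c \<ge> 3" and m: "(CARD('a) = 2 \<and> m = 1) \<or> m \<ge> 2"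
  shows "length c \<ge> 8"
proof (rule ccontr)
  let ?G = "L_graph TYPE('a) m"
  assume "\<not> length c \<ge> 8"
  \<comment> \<open>\<open>tl\<close> drops only the initial \<open>u\<close>; the final one
    remains, so \<open>u\<close> too differs from the inner vertices.\<close>
  obtain u where u: "set c \<subseteq> parcs ?G" "pcas u c u" "distinct (tl (pawalk_verts u c))"
    using cyc by (auto simp: L_graph_cycle_iff)
  have "even (length c)" using L_graph_walk_parity[OF u(1,2)] by simp
  with \<open>length c \<ge> 3\<close> \<open>\<not> length c \<ge> 8\<close> have "length c \<in> {4, 6}"
    by (auto elim!: evenE)
  then consider "length c = 4" | "length c = 6" by blast
  then show False
  proof cases
    case 1
    then obtain v1 v2 v3 where "c = [(u, v1), (v1, v2), (v2, v3), (v3, u)]"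
      using u(2) by (auto simp: numeral_eq_Suc length_Suc_conv)
    moreover from m have "m \<ge> 1" by auto
    ultimately show False
      using u(1,3) by (cases u; cases v1; cases v2; cases v3) (auto dest: no_square[simplified])
  next
    case 2
    then obtain v1 v2 v3 v4 v5
      where c: "c = [(u, v1), (v1, v2), (v2, v3), (v3, v4), (v4, v5), (v5, u)]"
      using u(2) by (auto simp: numeral_eq_Suc length_Suc_conv)
    have hexagon: False
      if "{p, q, r, a, b, d} \<subseteq> vectors (m + 1)" "distinct [p, q, r]" "distinct [a, b, d]"
        "incident m p a" "incident m q a" "incident m q b" "incident m r b"
        "incident m r d" "incident m p d" for p q r a b d :: "nat \<Rightarrow> 'a"
      using m that no_hexagon[of p m q r b d a] no_hexagon_two_elements[of p m q r a b d] by auto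
    show False
    proof (cases u)
      case (Inl p)
      with u(1) c obtain a q b r d where
        "v1 = Inr a" "v2 = Inl q" "v3 = Inr b" "v4 = Inl r" "v5 = Inr d"
        by (cases v1; cases v2; cases v3; cases v4; cases v5) auto
      with u(1,3) c Inl show False by (intro hexagon[of p q r a b d]) auto
    next
      case (Inr d)
      \<comment> \<open>Read from the line \<open>d\<close> joining \<open>r\<close> and
        \<open>p\<close>, the same hexagon has the cyclic order
        \<open>d, p, a, q, b, r\<close>.\<close>
      with u(1) c obtain a q b r p where
        "v1 = Inl p" "v2 = Inr a" "v3 = Inl q" "v4 = Inr b" "v5 = Inl r"
        by (cases v1; cases v2; cases v3; cases v4; cases v5) auto
      with u(1,3) c Inr show False by (intro hexagon[of p q r a b d]) auto
    qed
  qed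
qed

text \<open>Translation by 1 permutes the field, so adding 1 to each of the \<open>2 ^ e\<close>
  elements keeps their sum. Hence \<open>2 ^ e = 0\<close> in the field, which has no zero
  divisors.\<close>

lemma two_eq_zero_if_card_power_two:
  assumes "CARD('a::{field,finite}) = 2 ^ e"
  shows "(2::'a) = 0"
proof -
  have "(\<Sum>x\<in>UNIV. x) = (\<Sum>x\<in>UNIV. x + (1::'a))"
    by (rule sum.reindex_bij_witness[of _ "\<lambda>x. x + 1" "\<lambda>x. x - 1"]) auto
  also have "\<dots> = (\<Sum>x\<in>UNIV. x) + 2 ^ e"
    using assms by (simp add: sum.distrib)
  finally show ?thesis by simp
qed

definition const_tail :: "nat \<Rightarrow> 'a \<Rightarrow> 'a \<Rightarrow> nat \<Rightarrow> 'a" where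
  "const_tail m x y = (\<lambda>k \<in> {1..m + 1}. if k = 1 then x else y)"

lemma const_tail_in_vectors: "const_tail m x y \<in> vectors (m + 1)"
  by (auto simp: const_tail_def)

text \<open>Since \<open>m \<ge> 1\<close>, coordinate 2 exists and recovers
  \<open>y\<close>.\<close>

lemma const_tail_eq_iff [simp]:
  assumes "m \<ge> 1"
  shows "const_tail m x y = const_tail m x' y' \<longleftrightarrow> x = x' \<and> y = y'"
proof
  assume "const_tail m x y = const_tail m x' y'"
  from fun_cong[OF this, of 1] fun_cong[OF this, of 2] assms show "x = x' \<and> y = y'"
    by (simp add: const_tail_def)
qed simp

text \<open>The powers with exponent \<open>2 ^ (k - 2)\<close> fix 0 and 1, so all incidence
  equations reduce to the same one.\<close>

lemma incident_const_tail:
  assumes "x \<in> {0, 1}" "b + y = x * a"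
  shows "incident m (const_tail m x y) (const_tail m a b)"
  using assms by (auto simp: incident_def const_tail_def)

lemma L_graph_octagon:
  assumes two: "(2::'a::field) = 0" and m: "m \<ge> 1"
  shows "\<exists>c. pre_digraph.cycle (with_proj (L_graph TYPE('a) m)) c \<and> length c = 8"
proof -
  let ?P = "\<lambda>x y. Inl (const_tail m x y) :: (nat \<Rightarrow> 'a) + (nat \<Rightarrow> 'a)"
  let ?L = "\<lambda>a b. Inr (const_tail m a b) :: (nat \<Rightarrow> 'a) + (nat \<Rightarrow> 'a)"
  \<comment> \<open>Each pair over 0 and 1 occurs once as a point and once as a line. Neighbours
    satisfy \<open>b + y = x * a\<close>, in three cases because \<open>1 + 1 = 0\<close>.\<close>
  let ?c = "[(?P 0 0, ?L 0 0), (?L 0 0, ?P 1 0), (?P 1 0, ?L 1 1), (?L 1 1, ?P 0 1),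
    (?P 0 1, ?L 0 1), (?L 0 1, ?P 1 1), (?P 1 1, ?L 1 0), (?L 1 0, ?P 0 0)]"
  have "(1::'a) + 1 = 0" using two by simp
  then have "pre_digraph.cycle (with_proj (L_graph TYPE('a) m)) ?c"
    using m unfolding L_graph_cycle_iff
    by (intro exI[of _ "?P 0 0"]) (simp add: const_tail_in_vectors[simplified] incident_const_tail)
  then show ?thesis by (intro exI[of _ ?c]) simp
qed

theorem theorem5p4:
  fixes e m :: nat
  assumes "CARD('a::{field,finite}) = 2 ^ e"
    and "(e = 1 \<and> m = 1) \<or> (e \<ge> 1 \<and> m \<ge> 2)"
  shows "girth (L_graph TYPE('a) m) = 8"
  unfolding girth_def
proof (rule antisym)
  let ?C = "{c. pre_digraph.cycle (with_proj (L_graph TYPE('a) m)) c \<and> length c \<ge> 3}"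
  have "(2::'a) = 0" using assms(1) by (rule two_eq_zero_if_card_power_two)
  then obtain c where "c \<in> ?C" "length c = 8"
    using L_graph_octagon[where 'a = 'a and m = m] assms(2) by auto
  then show "(INF c \<in> ?C. enat (length c)) \<le> 8"
    by (intro INF_lower2[of c]) (auto simp: numeral_eq_enat)
  \<comment> \<open>If \<open>m = 1\<close>, then \<open>e = 1\<close>, so the field has two
    elements.\<close>
  have "(CARD('a) = 2 \<and> m = 1) \<or> m \<ge> 2" using assms by auto
  then show "8 \<le> (INF c \<in> ?C. enat (length c))"
    using L_graph_cycle_length_ge[where 'a = 'a] by (intro INF_greatest) (auto simp: numeral_eq_enat)
qed

end
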